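(* Let $K$ be the transition matrix of an irreducible aperiodic Markov chain on a finite state space $\mathcal X$ with stationary distribution $\pi$, let $\phi$ be a transition rule for $K$ with driving variable $\mathbf U$, and assume that CFTP based on $\phi$ terminates with probability $1$. Let $T_{\mathrm{CFTP}}$ and $Z_{\mathrm{CFTP}}$ be the running time and the output of CFTP, and let $T_{\mathrm{FMMR}}$ and $Z_{\mathrm{FMMR}}$ be the running time and the initial state of the FMMR algorithm, both algorithms using the same $\phi$. For a time window of length $t$ put $$p_{\mathrm{CFTP}}(z):=P(T_{\mathrm{CFTP}}\le t\mid Z_{\mathrm{CFTP}}=z),\qquad p_{\mathrm{CFTP}}:=P(T_{\mathrm{CFTP}}\le t),\qquad p_{\mathrm{FMMR}}(z):=P(T_{\mathrm{FMMR}}\le t\mid Z_{\mathrm{FMMR}}=z).$$ Then: (1) for every fixed $t$, $p_{\mathrm{CFTP}}(z)=p_{\mathrm{FMMR}}(z)$ for $\pi$-almost every $z$; (2) for every fixed $t$, $p_{\mathrm{CFTP}}=\mathbf E_{\pi}[p_{\mathrm{FMMR}}(Z_{\mathrm{FMMR}})]=\sum_{z}\pi(z)\,p_{\mathrm{FMMR}}(z)$; (3) $\mathcal L(T_{\mathrm{CFTP}}\mid Z_{\mathrm{CFTP}}=z)=\mathcal L(T_{\mathrm{FMMR}}\mid Z_{\mathrm{FMMR}}=z)$ for $\pi$-almost every $z$; (4) $\mathcal L(T_{\mathrm{CFTP}})$ is the $\pi$-mixture (over $z$) of the distributions $\mathcal L(T_{\mathrm{FMMR}}\mid Z_{\ma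thrm{FMMR}}=z)$.
   Context: $\mathcal L(X)$ denotes the distribution of the random variable $X$. A transition rule for $K$ is a function $\phi:\mathcal X\times\mathcal U\to\mathcal X$ together with a random variable $\mathbf U$ with values in $\mathcal U$ such that $P(\phi(x,\mathbf U)=y)=K(x,y)$ for all $x,y\in\mathcal X$. CFTP (coupling from the past): let $\mathbf U_0,\mathbf U_{-1},\mathbf U_{-2},\dots$ be i.i.d. copies of $\mathbf U$. For $t=0,1,2,\dots$ start a copy of the chain from every state $x$ at time $-t$ and update all copies by $x_s=\phi(x_{s-1},\mathbf U_s)$, $-t+1\le s\le 0$. Trajectories coalesce over the window of length $t$ if all copies agree at time $0$. The running time $T_{\mathrm{CFTP}}$ is the smallest $t$ for which coalescence occurs, and the output $Z_{\mathrm{CFTP}}$ is the common value at time $0$; "terminates with probability $1$" means $T_{\mathrm{CFTP}}<\infty$ almost surely (and then $Z_{\mathrm{CFTP}}\sim\pi$). FMMR: let $\tilde K$ be the time-reversal of $K$, defined by $\pi(x)K(x,y)=\pi(y)\tilde K(y,x)$. Start in an initial state $\mathbf X_0=Z_{\mathrm{FMMR}}$ and run $\tilde K$ to obtain $\mathbf X_0,\mathbf X_{-1},\mathbf X_{-2},\dots$. Conditionally given the $\mathbf X$-values, generate $\mathbf U_0,\mathbf U_{-1},\dots$ independently, with $\mathbf U_s$ drawn from the conditional distribution of $\mathbf U$ given $\phi(\mathbf X_{s-1},\mathbf U)=\mathbf X_s$. For $t=0,1,\dots$ and $x\in\mathcal X$ set $\mathbf Y^{(-t)}_{-t}(x)=x$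 and $\mathbf Y^{(-t)}_s(x)=\phi(\mathbf Y^{(-t)}_{s-1}(x),\mathbf U_s)$ for $-t+1\le s\le 0$. The running time $T_{\mathrm{FMMR}}$ is the smallest $t$ such that the values $\mathbf Y^{(-t)}_0(x)$, $x\in\mathcal X$, all agree (and hence all equal $\mathbf X_0$). Conditioning on $Z_{\mathrm{FMMR}}=z$ means running FMMR from initial state $\mathbf X_0=z$. *)

theory Defs
  imports "HOL-Probability.Probability"
begin

section \<open>Finite Markov chains\<close>

definition stochastic :: "('a::finite \<Rightarrow> 'a \<Rightarrow> real) \<Rightarrow> bool" where
  "stochastic K \<longleftrightarrow> (\<forall>x y. 0 \<le> K x y) \<and> (\<forall>x. (\<Sum>y\<in>UNIV. K x y) = 1)"

primrec n_step :: "('a::finite \<Rightarrow> 'a \<Rightarrow> real) \<Rightarrow> nat \<Rightarrow> 'a \<Rightarrow> 'a \<Rightarrow> real" where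
  "n_step K 0 x y = (if x = y then 1 else 0)"
| "n_step K (Suc n) x y = (\<Sum>w\<in>UNIV. K x w * n_step K n w y)"

definition irreducible_chain :: "('a::finite \<Rightarrow> 'a \<Rightarrow> real) \<Rightarrow> bool" where
  "irreducible_chain K \<longleftrightarrow> (\<forall>x y. \<exists>n. n_step K n x y > 0)"

definition aperiodic_chain :: "('a::finite \<Rightarrow> 'a \<Rightarrow> real) \<Rightarrow> bool" where
  "aperiodic_chain K \<longleftrightarrow> (\<forall>x. Gcd {n. 0 < n \<and> n_step K n x x > 0} = (1::nat))"

definition stationary_distribution :: "('a::finite \<Rightarrow> 'a \<Rightarrow> real) \<Rightarrow> 'a pmf \<Rightarrow> bool" where
  "stationary_distribution K \<pi> \<longleftrightarrow> (\<forall>y. (\<Sum>x\<in>UNIV. pmf \<pi> x * K x y) = pmf \<pi> y)"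

definition time_reversal ::
    "'a pmf \<Rightarrow> ('a::finite \<Rightarrow> 'a \<Rightarrow> real) \<Rightarrow> ('a \<Rightarrow> 'a \<Rightarrow> real) \<Rightarrow> bool" where
  "time_reversal \<pi> K Kt \<longleftrightarrow> (\<forall>x y. pmf \<pi> x * K x y = pmf \<pi> y * Kt y x)"

text \<open>
  The driving variable enters only through its law \<open>\<nu>\<close>, a probability measure on an arbitrary
  measurable space.
\<close>

definition transition_rule ::
    "('a::finite \<Rightarrow> 'a \<Rightarrow> real) \<Rightarrow> ('a \<Rightarrow> 'u \<Rightarrow> 'a) \<Rightarrow> 'u measure \<Rightarrow> bool" where
  "transition_rule K \<phi> \<nu> \<longleftrightarrow>
     prob_space \<nu> \<and>
     (\<forall>x. \<phi> x \<in> measurable \<nu> (count_space UNIV)) \<and>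
     (\<forall>x y. measure \<nu> {u \<in> space \<nu>. \<phi> x u = y} = K x y)"


section \<open>Coalescence\<close>

text \<open>
  Times run over \<open>0, -1, -2, \<dots>\<close> and are indexed by their absolute values: \<open>u i\<close> is the value of the
  driving variable at time \<open>-i\<close>.  The value at time \<open>-t + k\<close> of the trajectory that starts in
  \<open>x\<close> at time \<open>-t\<close> is \<open>trajectory \<phi> u t x k\<close> (for \<open>k \<le> t\<close>), so its value at time \<open>0\<close> is
  \<open>trajectory \<phi> u t x t\<close>; the update to time \<open>-t + (k + 1)\<close> uses \<open>u (t - (k + 1))\<close>.
\<close>

primrec trajectory ::
    "('a \<Rightarrow> 'u \<Rightarrow> 'a) \<Rightarrow> (nat \<Rightarrow> 'u) \<Rightarrow> nat \<Rightarrow> 'a \<Rightarrow> nat \<Rightarrow> 'a" where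
  "trajectory \<phi> u t x 0 = x"
| "trajectory \<phi> u t x (Suc k) = \<phi> (trajectory \<phi> u t x k) (u (t - Suc k))"

definition coalesces_to :: "('a \<Rightarrow> 'u \<Rightarrow> 'a) \<Rightarrow> (nat \<Rightarrow> 'u) \<Rightarrow> nat \<Rightarrow> 'a \<Rightarrow> bool" where
  "coalesces_to \<phi> u t z \<longleftrightarrow> (\<forall>x. trajectory \<phi> u t x t = z)"

text \<open>The infimum of the empty set is \<open>\<infinity>\<close>.\<close>

definition coalescence_time :: "('a \<Rightarrow> 'u \<Rightarrow> 'a) \<Rightarrow> (nat \<Rightarrow> 'u) \<Rightarrow> enat" where
  "coalescence_time \<phi> u = Inf {enat t | t. \<exists>z. coalesces_to \<phi> u t z}"

text \<open>The common value at time \<open>0\<close>; unspecified if the coalescence time is infinite.\<close>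

definition coalescence_value :: "('a \<Rightarrow> 'u \<Rightarrow> 'a) \<Rightarrow> (nat \<Rightarrow> 'u) \<Rightarrow> 'a" where
  "coalescence_value \<phi> u =
     (THE z. \<exists>t. coalescence_time \<phi> u = enat t \<and> coalesces_to \<phi> u t z)"


section \<open>CFTP and FMMR\<close>

definition iid_copies :: "'u measure \<Rightarrow> 'w measure \<Rightarrow> (nat \<Rightarrow> 'w \<Rightarrow> 'u) \<Rightarrow> bool" where
  "iid_copies \<nu> M U \<longleftrightarrow>
     prob_space M \<and>
     prob_space.indep_vars M (\<lambda>_. \<nu>) U UNIV \<and>
     (\<forall>i. distr M \<nu> (U i) = \<nu>)"

definition T_cftp :: "('a \<Rightarrow> 'u \<Rightarrow> 'a) \<Rightarrow> (nat \<Rightarrow> 'w \<Rightarrow> 'u) \<Rightarrow> 'w \<Rightarrow> enat" where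
  "T_cftp \<phi> U \<omega> = coalescence_time \<phi> (\<lambda>i. U i \<omega>)"

definition Z_cftp :: "('a \<Rightarrow> 'u \<Rightarrow> 'a) \<Rightarrow> (nat \<Rightarrow> 'w \<Rightarrow> 'u) \<Rightarrow> 'w \<Rightarrow> 'a" where
  "Z_cftp \<phi> U \<omega> = coalescence_value \<phi> (\<lambda>i. U i \<omega>)"

text \<open>
  The conditional law of the driving variable \<open>u\<close> given \<open>\<phi> x u = y\<close>.  This is only used when
  the conditioning event has positive probability.
\<close>

definition driving_law_given ::
    "('a \<Rightarrow> 'u \<Rightarrow> 'a) \<Rightarrow> 'u measure \<Rightarrow> 'a \<Rightarrow> 'a \<Rightarrow> 'u measure" where
  "driving_law_given \<phi> \<nu> x y = uniform_measure \<nu> {u \<in> space \<nu>. \<phi> x u = y}"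

text \<open>
  A run of FMMR from the initial state \<open>z\<close> on the probability space \<open>N\<close>: \<open>X i\<close> and \<open>V i\<close> are the
  state and the driving variable at time \<open>-i\<close>.  The third conjunct says that \<open>X\<close> is a Markov chain
  with transition matrix \<open>Kt\<close> started in \<open>z\<close>.  The last one says that, given \<open>X\<close>, the \<open>V i\<close> are
  independent, \<open>V i\<close> having the law of the driving variable \<open>u\<close> given
  \<open>\<phi> (X (Suc i)) u = X i\<close>; longer stretches of \<open>X\<close> in the condition are covered by taking
  \<open>A i = space \<nu>\<close> for the excess indices \<open>i\<close>.
\<close>

definition fmmr_run ::
    "('a::finite \<Rightarrow> 'u \<Rightarrow> 'a) \<Rightarrow> 'u measure \<Rightarrow> ('a \<Rightarrow> 'a \<Rightarrow> real) \<Rightarrow> 'a \<Rightarrow>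
     'v measure \<Rightarrow> (nat \<Rightarrow> 'v \<Rightarrow> 'a) \<Rightarrow> (nat \<Rightarrow> 'v \<Rightarrow> 'u) \<Rightarrow> bool" where
  "fmmr_run \<phi> \<nu> Kt z N X V \<longleftrightarrow>
     prob_space N \<and>
     (\<forall>i. X i \<in> measurable N (count_space UNIV) \<and> V i \<in> measurable N \<nu>) \<and>
     (\<forall>n x. \<P>(\<omega> in N. \<forall>i\<le>n. X i \<omega> = x i) =
        (if x 0 = z then 1 else 0) * (\<Prod>i<n. Kt (x i) (x (Suc i)))) \<and>
     (\<forall>n x A. (\<forall>i<n. A i \<in> sets \<nu>) \<longrightarrow> \<P>(\<omega> in N. \<forall>i\<le>n. X i \<omega> = x i) > 0 \<longrightarrow>
        cond_prob N (\<lambda>\<omega>. \<forall>i<n. V i \<omega> \<in> A i) (\<lambda>\<omega>. \<forall>i\<le>n. X i \<omega> = x i) =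
        (\<Prod>i<n. measure (driving_law_given \<phi> \<nu> (x (Suc i)) (x i)) (A i)))"

definition T_fmmr :: "('a \<Rightarrow> 'u \<Rightarrow> 'a) \<Rightarrow> (nat \<Rightarrow> 'v \<Rightarrow> 'u) \<Rightarrow> 'v \<Rightarrow> enat" where
  "T_fmmr \<phi> V \<omega> = coalescence_time \<phi> (\<lambda>i. V i \<omega>)"

definition p_cftp_given ::
    "('a \<Rightarrow> 'u \<Rightarrow> 'a) \<Rightarrow> 'w measure \<Rightarrow> (nat \<Rightarrow> 'w \<Rightarrow> 'u) \<Rightarrow> nat \<Rightarrow> 'a \<Rightarrow> real" where
  "p_cftp_given \<phi> M U t z = cond_prob M (\<lambda>\<omega>. T_cftp \<phi> U \<omega> \<le> enat t) (\<lambda>\<omega>. Z_cftp \<phi> U \<omega> = z)"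

definition p_cftp ::
    "('a \<Rightarrow> 'u \<Rightarrow> 'a) \<Rightarrow> 'w measure \<Rightarrow> (nat \<Rightarrow> 'w \<Rightarrow> 'u) \<Rightarrow> nat \<Rightarrow> real" where
  "p_cftp \<phi> M U t = \<P>(\<omega> in M. T_cftp \<phi> U \<omega> \<le> enat t)"

text \<open>
  For FMMR, conditioning on the initial state means running the algorithm from it: \<open>N z\<close> and
  \<open>V z\<close> are the probability space and the driving variables of the run from \<open>z\<close>.
\<close>

definition p_fmmr ::
    "('a \<Rightarrow> 'u \<Rightarrow> 'a) \<Rightarrow> ('a \<Rightarrow> 'v measure) \<Rightarrow> ('a \<Rightarrow> nat \<Rightarrow> 'v \<Rightarrow> 'u) \<Rightarrow> nat \<Rightarrow> 'a \<Rightarrow> real" where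
  "p_fmmr \<phi> N V t z = \<P>(\<omega> in N z. T_fmmr \<phi> (V z) \<omega> \<le> enat t)"

definition law_T_cftp ::
    "('a \<Rightarrow> 'u \<Rightarrow> 'a) \<Rightarrow> 'w measure \<Rightarrow> (nat \<Rightarrow> 'w \<Rightarrow> 'u) \<Rightarrow> enat measure" where
  "law_T_cftp \<phi> M U = distr M (count_space UNIV) (T_cftp \<phi> U)"

definition law_T_cftp_given ::
    "('a \<Rightarrow> 'u \<Rightarrow> 'a) \<Rightarrow> 'w measure \<Rightarrow> (nat \<Rightarrow> 'w \<Rightarrow> 'u) \<Rightarrow> 'a \<Rightarrow> enat measure" where
  "law_T_cftp_given \<phi> M U z =
     distr (uniform_measure M {\<omega> \<in> space M. Z_cftp \<phi> U \<omega> = z}) (count_space UNIV) (T_cftp \<phi> U)"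

definition law_T_fmmr_given ::
    "('a \<Rightarrow> 'u \<Rightarrow> 'a) \<Rightarrow> ('a \<Rightarrow> 'v measure) \<Rightarrow> ('a \<Rightarrow> nat \<Rightarrow> 'v \<Rightarrow> 'u) \<Rightarrow> 'a \<Rightarrow> enat measure" where
  "law_T_fmmr_given \<phi> N V z = distr (N z) (count_space UNIV) (T_fmmr \<phi> (V z))"

end

theory Submission imports Defs begin

text \<open>
  Run from \<open>z\<close>, FMMR sees a given sequence of driving maps \<open>f\<close> together with a backward path \<open>x\<close>
  only if \<open>f\<close> drives the chain forward along \<open>x\<close>.  Time reversal turns \<open>\<pi> z\<close> times the
  probability of this into \<open>\<pi>\<close> of the earliest state of \<open>x\<close> times the probability of \<open>f\<close> under
  independent driving variables.  If \<open>f\<close> coalesces, then exactly one path from each earliest state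
  ends in the common value, and summing over these paths gives
  \<open>P (T\<^sub>C\<^sub>F\<^sub>T\<^sub>P \<le> t, Z\<^sub>C\<^sub>F\<^sub>T\<^sub>P = z) = \<pi> z * P (T\<^sub>F\<^sub>M\<^sub>M\<^sub>R \<le> t | Z\<^sub>F\<^sub>M\<^sub>M\<^sub>R = z)\<close>.  As \<open>t\<close> tends to infinity this
  bounds \<open>P (Z\<^sub>C\<^sub>F\<^sub>T\<^sub>P = z)\<close> by \<open>\<pi> z\<close>, with equality because both sum to \<open>1\<close>.  The claims on laws
  follow, since a law on the extended naturals is determined by its values on the sets
  \<open>{0, \<dots>, t}\<close>.
\<close>

section \<open>Coalescence\<close>

text \<open>The recursion of \<open>trajectory\<close> splits off the latest update; here the
  earliest one is split off, so that windows of different lengths can be compared.\<close>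

lemma trajectory_shift:
  "trajectory \<phi> u (Suc t) x (Suc k) = trajectory \<phi> u t (\<phi> x (u t)) k"
  by (induction k) auto

text \<open>A window reaching one step further back only replaces each start \<open>x\<close> by
  \<open>\<phi> x (u t)\<close>, and precomposing a constant map leaves it constant.\<close>

lemma coalesces_to_Suc:
  "coalesces_to \<phi> u t z \<Longrightarrow> coalesces_to \<phi> u (Suc t) z"
  unfolding coalesces_to_def trajectory_shift by simp

lemma coalesces_to_mono:
  assumes "s \<le> t" "coalesces_to \<phi> u s z"
  shows "coalesces_to \<phi> u t z"
  using assms by (induction t rule: dec_induct) (auto intro: coalesces_to_Suc)

lemma coalesces_to_unique:
  "coalesces_to \<phi> u t z \<Longrightarrow> coalesces_to \<phi> u t z' \<Longrightarrow> z = z'"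
  by (simp add: coalesces_to_def)

lemma coalescence_time_le_iff:
  "coalescence_time \<phi> u \<le> enat t \<longleftrightarrow> (\<exists>z. coalesces_to \<phi> u t z)"
proof -
  \<comment> \<open>A strict upper bound on an infimum is witnessed by an element of the set, hence
    the passage to \<open><\<close>.\<close>
  have "coalescence_time \<phi> u \<le> enat t \<longleftrightarrow> coalescence_time \<phi> u < enat (Suc t)"
    by (cases "coalescence_time \<phi> u") auto
  also have "\<dots> \<longleftrightarrow> (\<exists>s\<le>t. \<exists>z. coalesces_to \<phi> u s z)"
    unfolding coalescence_time_def Inf_less_iff by (force simp: less_Suc_eq_le)
  also have "\<dots> \<longleftrightarrow> (\<exists>z. coalesces_to \<phi> u t z)"
    by (meson coalesces_to_mono order_refl)
  finally show ?thesis .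
qed

lemma coalescence_value_eq:
  assumes "coalesces_to \<phi> u t z"
  shows "coalescence_value \<phi> u = z"
proof -
  have "coalescence_time \<phi> u \<le> enat t"
    using assms coalescence_time_le_iff by blast
  then obtain s where s: "coalescence_time \<phi> u = enat s" "s \<le> t"
    by (cases "coalescence_time \<phi> u") auto
  then obtain z' where z': "coalesces_to \<phi> u s z'"
    using coalescence_time_le_iff[of \<phi> u s] by auto
  have "z' = z"
    using coalesces_to_mono[OF s(2) z'] assms coalesces_to_unique by metis
  with s z' show ?thesis
    unfolding coalescence_value_def
    by (intro the_equality) (auto dest: coalesces_to_unique)
qed

text \<open>Turns the joint event for running time and output into an event on a fixed window. The
  bound on the time excludes the case where the value is unspecified.\<close>

lemma coalesces_to_iff:
  "coalesces_to \<phi> u t z \<longleftrightarrow> coalescence_time \<phi> u \<le> enat t \<and> coalescence_value \<phi> u = z"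
  using coalescence_time_le_iff coalescence_value_eq by metis

text \<open>
  Coalescence depends on a driving variable \<open>u\<close> only through the self-map \<open>\<lambda>x. \<phi> x u\<close> of the state
  space, and such maps are finite in number.
\<close>

lemma trajectory_maps_cong:
  assumes "\<And>i. i < t \<Longrightarrow> (\<lambda>x. \<phi> x (u i)) = f i" and "k \<le> t"
  shows "trajectory \<phi> u t x k = trajectory (\<lambda>x g. g x) f t x k"
  using \<open>k \<le> t\<close>
proof (induction k)
  case (Suc k)
  then show ?case
    using fun_cong[OF assms(1)[of "t - Suc k"], of "trajectory \<phi> u t x k"] by simp
qed simp

lemma coalesces_to_maps_cong:
  assumes "\<And>i. i < t \<Longrightarrow> (\<lambda>x. \<phi> x (u i)) = f i"
  shows "coalesces_to \<phi> u t z \<longleftrightarrow> coalesces_to (\<lambda>x g. g x) f t z"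
  unfolding coalesces_to_def using trajectory_maps_cong[of t \<phi> u f t] assms by simp


section \<open>Measurability\<close>

lemma measurable_trajectory:
  fixes \<phi> :: "'a::finite \<Rightarrow> 'u \<Rightarrow> 'a"
  assumes [measurable]: "\<And>x. \<phi> x \<in> measurable \<nu> (count_space UNIV)" "\<And>i. W i \<in> measurable Q \<nu>"
  shows "(\<lambda>\<omega>. trajectory \<phi> (\<lambda>i. W i \<omega>) t x k) \<in> measurable Q (count_space UNIV)"
proof (induction k)
  case (Suc k)
  \<comment> \<open>The update is measurable for each fixed state \<open>y\<close>; the random
    current state then takes only countably many values.\<close>
  have "(\<lambda>\<omega>. \<phi> y (W (t - Suc k) \<omega>)) \<in> measurable Q (count_space UNIV)" for y
    by measurable
  from measurable_compose_countable[OF this Suc] show ?case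
    by simp
qed simp

lemma pred_coalesces_to:
  fixes \<phi> :: "'a::finite \<Rightarrow> 'u \<Rightarrow> 'a"
  assumes "\<And>x. \<phi> x \<in> measurable \<nu> (count_space UNIV)" "\<And>i. W i \<in> measurable Q \<nu>"
  shows "Measurable.pred Q (\<lambda>\<omega>. coalesces_to \<phi> (\<lambda>i. W i \<omega>) t z)"
proof -
  note [measurable] = measurable_trajectory[OF assms]
  show ?thesis
    unfolding coalesces_to_def by measurable
qed

section \<open>Laws on the extended naturals and decomposition over finitely many values\<close>

lemma sigma_sets_atMost_enat:
  "sigma_sets UNIV (range atMost) = (UNIV :: enat set set)"
proof -
  let ?S = "sigma_sets UNIV (range atMost) :: enat set set"
  interpret sigma_algebra UNIV ?S
    by (rule sigma_algebra_sigma_sets) simp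
  have le: "{..a} \<in> ?S" for a
    by (rule sigma_sets.Basic) simp
  have less: "{..<a} \<in> ?S" for a :: enat
  proof -
    \<comment> \<open>Every element below \<open>a\<close> is finite, so this covers
      \<open>a = \<infinity>\<close> as well. Singletons are then differences, and every set is a
      countable union of singletons.\<close>
    have "{..<a} = (\<Union>n\<in>{n. enat n < a}. {..enat n})"
    proof (intro set_eqI)
      fix x show "x \<in> {..<a} \<longleftrightarrow> x \<in> (\<Union>n\<in>{n. enat n < a}. {..enat n})"
        by (cases x) (auto intro: le_less_trans[rotated])
    qed
    also have "\<dots> \<in> ?S"
      by (intro countable_UN' countableI_type) (auto intro: le)
    finally show ?thesis .
  qed
  have "{a} \<in> ?S" for a
  proof -
    have "{a} = {..a} - {..<a}" by auto
    then show ?thesis using le less by auto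
  qed
  then have "(\<Union>a\<in>A. {a}) \<in> ?S" for A
    by (intro countable_UN' countableI_type) auto
  then show ?thesis by auto
qed

text \<open>Finite bounds suffice, since \<open>{..\<infinity>}\<close> is the whole space.\<close>

lemma measurable_enatI:
  fixes f :: "'w \<Rightarrow> enat"
  assumes "\<And>t. {\<omega> \<in> space Q. f \<omega> \<le> enat t} \<in> sets Q"
  shows "f \<in> measurable Q (count_space UNIV)"
proof -
  have "f \<in> measurable Q (sigma UNIV (range atMost))"
  proof (rule measurable_measure_of)
    fix A assume "A \<in> range (atMost :: enat \<Rightarrow> _)"
    then obtain e where "A = {..e}" by auto
    then have "f -` A \<inter> space Q = {\<omega> \<in> space Q. f \<omega> \<le> e}" by auto
    then show "f -` A \<inter> space Q \<in> sets Q"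
      using assms by (cases e) auto
  qed auto
  also have "measurable Q (sigma UNIV (range atMost)) = measurable Q (count_space (UNIV :: enat set))"
    by (rule measurable_cong_sets) (auto simp: sigma_sets_atMost_enat)
  finally show ?thesis .
qed

text \<open>The sets \<open>{..e}\<close> form a generating \<pi>-system. The mass at \<infinity> is
  what the finite values leave of the total mass 1.\<close>

lemma measure_eqI_enat:
  fixes P Q :: "enat measure"
  assumes "prob_space P" "prob_space Q" and sets: "sets P = UNIV" "sets Q = UNIV"
    and eq: "\<And>t. measure P {..enat t} = measure Q {..enat t}"
  shows "P = Q"
proof -
  interpret P: prob_space P by fact
  interpret Q: prob_space Q by fact
  have space: "space P = UNIV" "space Q = UNIV"
    using sets sets_eq_imp_space_eq[of _ "count_space UNIV"] by auto
  have *: "emeasure P {..e} = emeasure Q {..e}" for e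
  proof (cases e)
    case (enat t)
    then show ?thesis using eq by (simp add: P.emeasure_eq_measure Q.emeasure_eq_measure)
  next
    case infinity
    then have "{..e} = UNIV" by auto
    then show ?thesis using P.emeasure_space_1 Q.emeasure_space_1 space by simp
  qed
  show ?thesis
  proof (rule measure_eqI_generator_eq[where E="range atMost" and \<Omega>=UNIV and A="\<lambda>_. {..\<infinity>}"])
    show "Int_stable (range (atMost :: enat \<Rightarrow> _))"
      by (auto simp: Int_stable_def)
  qed (use * in \<open>auto simp: sets sigma_sets_atMost_enat\<close>)
qed

text \<open>Partitions the event by the joint value of the \<open>F i\<close>. Extensional functions
  on \<open>I\<close> list each joint value exactly once, which makes the pieces disjoint.\<close>

lemma (in finite_measure) measure_sum_values:
  fixes F :: "'i \<Rightarrow> 'a \<Rightarrow> 'b::finite"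
  assumes "finite I" and [measurable]: "\<And>i. i \<in> I \<Longrightarrow> F i \<in> measurable M (count_space UNIV)"
    and R [measurable]: "Measurable.pred M R"
  shows "measure M {\<omega> \<in> space M. R \<omega>} =
    (\<Sum>x\<in>I \<rightarrow>\<^sub>E UNIV. measure M {\<omega> \<in> space M. R \<omega> \<and> (\<forall>i\<in>I. F i \<omega> = x i)})"
proof -
  let ?A = "\<lambda>x. {\<omega> \<in> space M. R \<omega> \<and> (\<forall>i\<in>I. F i \<omega> = x i)}"
  have "{\<omega> \<in> space M. R \<omega>} = (\<Union>x\<in>I \<rightarrow>\<^sub>E UNIV. ?A x)"
  proof safe
    fix \<omega> assume "\<omega> \<in> space M" "R \<omega>"
    then have "\<omega> \<in> ?A (restrict (\<lambda>i. F i \<omega>) I)" by auto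
    moreover have "restrict (\<lambda>i. F i \<omega>) I \<in> I \<rightarrow>\<^sub>E UNIV" by simp
    ultimately show "\<omega> \<in> (\<Union>x\<in>I \<rightarrow>\<^sub>E UNIV. ?A x)" by (rule UN_I[rotated])
  qed
  also have "measure M \<dots> = (\<Sum>x\<in>I \<rightarrow>\<^sub>E UNIV. measure M (?A x))"
  proof (rule finite_measure_finite_Union)
    show "finite (I \<rightarrow>\<^sub>E (UNIV :: 'b set))"
      using \<open>finite I\<close> by (intro finite_PiE) auto
    have "?A x \<in> sets M" for x
    proof -
      have "Measurable.pred M (\<lambda>\<omega>. F i \<omega> = x i)" if "i \<in> I" for i
        using that by measurable
      then have "Measurable.pred M (\<lambda>\<omega>. \<forall>i\<in>I. F i \<omega> = x i)"
        using \<open>finite I\<close> by (intro pred_intros_finite) auto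
      then show ?thesis by measurable
    qed
    then show "?A ` (I \<rightarrow>\<^sub>E UNIV) \<subseteq> sets M" by auto
    show "disjoint_family_on ?A (I \<rightarrow>\<^sub>E UNIV)"
      unfolding disjoint_family_on_def
    proof safe
      fix x y \<omega> assume "x \<in> I \<rightarrow>\<^sub>E (UNIV :: 'b set)" "y \<in> I \<rightarrow>\<^sub>E (UNIV :: 'b set)"
        and xy: "x \<noteq> y" "\<forall>i\<in>I. F i \<omega> = x i" "\<forall>i\<in>I. F i \<omega> = y i"
      then have "x = y" by (intro PiE_ext) auto
      with xy show "\<omega> \<in> {}" by simp
    qed
  qed
  finally show ?thesis .
qed


section \<open>The law of the driving maps\<close>

text \<open>These cells partition the arbitrary driving space into finitely many pieces, which
  reduces all later computations to finite sums.\<close>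

definition map_fiber :: "('a \<Rightarrow> 'u \<Rightarrow> 'a) \<Rightarrow> 'u measure \<Rightarrow> ('a \<Rightarrow> 'a) \<Rightarrow> 'u set" where
  "map_fiber \<phi> \<nu> g = {u \<in> space \<nu>. (\<lambda>x. \<phi> x u) = g}"

lemma measurable_driving_map:
  fixes \<phi> :: "'a::finite \<Rightarrow> 'u \<Rightarrow> 'a"
  assumes [measurable]: "\<And>x. \<phi> x \<in> measurable \<nu> (count_space UNIV)"
  shows "(\<lambda>u x. \<phi> x u) \<in> measurable \<nu> (count_space UNIV)"
proof -
  have "(\<lambda>u x. \<phi> x u) -` {g} \<inter> space \<nu> = {u \<in> space \<nu>. \<forall>x. \<phi> x u = g x}" for g
    by auto
  moreover have "{u \<in> space \<nu>. \<forall>x. \<phi> x u = g x} \<in> sets \<nu>" for g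
    by measurable
  ultimately show ?thesis
    by (subst measurable_count_space_eq2) auto
qed

lemma sets_map_fiber:
  fixes \<phi> :: "'a::finite \<Rightarrow> 'u \<Rightarrow> 'a"
  assumes "\<And>x. \<phi> x \<in> measurable \<nu> (count_space UNIV)"
  shows "map_fiber \<phi> \<nu> g \<in> sets \<nu>"
proof -
  note [measurable] = measurable_driving_map[OF assms]
  show ?thesis unfolding map_fiber_def by measurable
qed

lemma iid_copies_maps:
  fixes \<phi> :: "'a::finite \<Rightarrow> 'u \<Rightarrow> 'a"
  assumes \<phi>: "\<And>x. \<phi> x \<in> measurable \<nu> (count_space UNIV)" and "iid_copies \<nu> M U"
  shows "measure M {\<omega> \<in> space M. \<forall>i<t. (\<lambda>x. \<phi> x (U i \<omega>)) = f i} =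
    (\<Prod>i<t. measure \<nu> (map_fiber \<phi> \<nu> (f i)))"
proof -
  interpret prob_space M
    using assms by (simp add: iid_copies_def)
  have indep: "indep_vars (\<lambda>_. \<nu>) U UNIV" and distr: "\<And>i. distr M \<nu> (U i) = \<nu>"
    using assms by (auto simp: iid_copies_def)
  then have U: "U i \<in> measurable M \<nu>" for i
    by (auto simp: indep_vars_def)
  show ?thesis
  \<comment> \<open>For \<open>t = 0\<close> an intersection over no indices would be
    \<open>UNIV\<close> instead of \<open>space M\<close>.\<close>
  proof (cases "t = 0")
    case False
    have "{\<omega> \<in> space M. \<forall>i<t. (\<lambda>x. \<phi> x (U i \<omega>)) = f i} =
      (\<Inter>i\<in>{..<t}. U i -` map_fiber \<phi> \<nu> (f i) \<inter> space M)"
      using False measurable_space[OF U] by (auto simp: map_fiber_def)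
    also have "prob \<dots> = (\<Prod>i<t. prob (U i -` map_fiber \<phi> \<nu> (f i) \<inter> space M))"
      using False by (intro indep_varsD[OF indep]) (auto intro: sets_map_fiber \<phi>)
    also have "\<dots> = (\<Prod>i<t. measure (distr M \<nu> (U i)) (map_fiber \<phi> \<nu> (f i)))"
      by (intro prod.cong refl measure_distr[symmetric] U sets_map_fiber \<phi>)
    finally show ?thesis unfolding distr .
  qed (simp add: prob_space)
qed

section \<open>Time reversal along FMMR paths\<close>

lemma time_reversal_path:
  assumes "time_reversal \<pi> K Kt"
  shows "pmf \<pi> (x 0) * (\<Prod>i<n. Kt (x i) (x (Suc i))) = pmf \<pi> (x n) * (\<Prod>i<n. K (x (Suc i)) (x i))"
proof (induction n)
  case (Suc n)
  \<comment> \<open>The weight \<pi> is carried across one more edge. Indices grow into the past, so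
    \<open>K\<close> leads from \<open>x (Suc n)\<close> to \<open>x n\<close>.\<close>
  have rev: "pmf \<pi> (x (Suc n)) * K (x (Suc n)) (x n) = pmf \<pi> (x n) * Kt (x n) (x (Suc n))"
    using assms by (simp add: time_reversal_def)
  have "pmf \<pi> (x 0) * (\<Prod>i<Suc n. Kt (x i) (x (Suc i))) =
      (pmf \<pi> (x 0) * (\<Prod>i<n. Kt (x i) (x (Suc i)))) * Kt (x n) (x (Suc n))"
    by simp
  also have "\<dots> = (pmf \<pi> (x n) * Kt (x n) (x (Suc n))) * (\<Prod>i<n. K (x (Suc i)) (x i))"
    unfolding Suc by simp
  also have "\<dots> = pmf \<pi> (x (Suc n)) * (\<Prod>i<Suc n. K (x (Suc i)) (x i))"
    unfolding rev[symmetric] by simp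
  finally show ?case .
qed simp

text \<open>The identity holds also if \<open>K x y = 0\<close>, as then both sides vanish.\<close>

lemma driving_law_given_map_fiber:
  fixes \<phi> :: "'a::finite \<Rightarrow> 'u \<Rightarrow> 'a"
  assumes "transition_rule K \<phi> \<nu>"
  shows "K x y * measure (driving_law_given \<phi> \<nu> x y) (map_fiber \<phi> \<nu> g) =
    of_bool (g x = y) * measure \<nu> (map_fiber \<phi> \<nu> g)"
proof -
  interpret \<nu>: prob_space \<nu>
    using assms by (simp add: transition_rule_def)
  have \<phi>: "\<And>x. \<phi> x \<in> measurable \<nu> (count_space UNIV)"
    and K: "measure \<nu> {u \<in> space \<nu>. \<phi> x u = y} = K x y"
    using assms by (auto simp: transition_rule_def)
  let ?E = "{u \<in> space \<nu>. \<phi> x u = y}"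
  have E: "?E \<in> sets \<nu>"
    using \<phi>[of x] by measurable
  \<comment> \<open>On the fiber of \<open>g\<close> the map \<open>\<phi> x\<close> has the
    constant value \<open>g x\<close>, so \<open>?E\<close> contains the fiber or misses it.\<close>
  have "?E \<inter> map_fiber \<phi> \<nu> g = (if g x = y then map_fiber \<phi> \<nu> g else {})"
    by (auto simp: map_fiber_def)
  then have Int: "measure \<nu> (?E \<inter> map_fiber \<phi> \<nu> g) = of_bool (g x = y) * measure \<nu> (map_fiber \<phi> \<nu> g)"
    by simp
  show ?thesis
  proof (cases "K x y = 0")
    case True
    have "measure \<nu> (?E \<inter> map_fiber \<phi> \<nu> g) \<le> measure \<nu> ?E"
      by (intro \<nu>.finite_measure_mono E) auto
    then have "measure \<nu> (?E \<inter> map_fiber \<phi> \<nu> g) = 0"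
      using True K by (simp add: measure_le_0_iff)
    with True Int show ?thesis
      by simp
  next
    case False
    then have nz: "measure \<nu> ?E \<noteq> 0"
      using K by simp
    have "measure (uniform_measure \<nu> ?E) (map_fiber \<phi> \<nu> g) =
        measure \<nu> (?E \<inter> map_fiber \<phi> \<nu> g) / measure \<nu> ?E"
      using nz by (intro measure_uniform_measure sets_map_fiber \<phi>) (auto simp: \<nu>.emeasure_eq_measure)
    with False show ?thesis
      by (simp add: driving_law_given_def K Int)
  qed
qed

text \<open>Reversal turns the \<open>Kt\<close> factors into \<open>K\<close> factors, and each of
  these cancels the normalization of the conditional driving law on its edge. What remains is the
  unconditional weight of \<open>f\<close> and the condition that \<open>f\<close> drives along
  \<open>x\<close>.\<close>

lemma fmmr_run_path:
  fixes \<phi> :: "'a::finite \<Rightarrow> 'u \<Rightarrow> 'a"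
  assumes rule: "transition_rule K \<phi> \<nu>" and rev: "time_reversal \<pi> K Kt"
    and run: "fmmr_run \<phi> \<nu> Kt z N X V"
  shows "pmf \<pi> z * measure N {\<omega> \<in> space N. (\<forall>i<n. (\<lambda>x. \<phi> x (V i \<omega>)) = f i) \<and> (\<forall>i\<le>n. X i \<omega> = x i)} =
    of_bool (x 0 = z \<and> (\<forall>i<n. f i (x (Suc i)) = x i)) * pmf \<pi> (x n) *
      (\<Prod>i<n. measure \<nu> (map_fiber \<phi> \<nu> (f i)))"
    (is "_ * measure N ?E = ?r")
proof -
  interpret prob_space N
    using run by (simp add: fmmr_run_def)
  have \<phi>: "\<And>x. \<phi> x \<in> measurable \<nu> (count_space UNIV)"
    using rule by (auto simp: transition_rule_def)
  have V: "V i \<in> measurable N \<nu>" and X [measurable]: "X i \<in> measurable N (count_space UNIV)" for i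
    using run by (auto simp: fmmr_run_def)
  let ?P = "{\<omega> \<in> space N. \<forall>i\<le>n. X i \<omega> = x i}"
  let ?q = "\<Prod>i<n. measure (driving_law_given \<phi> \<nu> (x (Suc i)) (x i)) (map_fiber \<phi> \<nu> (f i))"
  have P: "prob ?P = of_bool (x 0 = z) * (\<Prod>i<n. Kt (x i) (x (Suc i)))"
    using run by (simp add: fmmr_run_def)
  have E: "?E = {\<omega> \<in> space N. (\<forall>i<n. V i \<omega> \<in> map_fiber \<phi> \<nu> (f i)) \<and> (\<forall>i\<le>n. X i \<omega> = x i)}"
    using measurable_space[OF V] by (auto simp: map_fiber_def)
  have "prob ?E = prob ?P * ?q"
  \<comment> \<open>The conditional law of the driving variables is prescribed only along paths of
    positive probability; on the others both sides vanish.\<close>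
  proof (cases "prob ?P = 0")
    case True
    have "prob ?E \<le> prob ?P"
      by (intro finite_measure_mono) auto
    with True show ?thesis
      by (simp add: measure_le_0_iff)
  next
    case False
    then have "prob ?P > 0"
      by (simp add: zero_less_measure_iff)
    moreover have "\<forall>i<n. map_fiber \<phi> \<nu> (f i) \<in> sets \<nu>"
      by (simp add: sets_map_fiber \<phi>)
    ultimately have "cond_prob N (\<lambda>\<omega>. \<forall>i<n. V i \<omega> \<in> map_fiber \<phi> \<nu> (f i)) (\<lambda>\<omega>. \<forall>i\<le>n. X i \<omega> = x i) = ?q"
      using run unfolding fmmr_run_def by meson
    with False show ?thesis
      unfolding cond_prob_def E by (simp add: field_simps)
  qed
  then have "pmf \<pi> z * prob ?E = of_bool (x 0 = z) * (pmf \<pi> (x 0) * (\<Prod>i<n. Kt (x i) (x (Suc i)))) * ?q"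
    by (simp add: P)
  also have "\<dots> = of_bool (x 0 = z) * pmf \<pi> (x n) * ((\<Prod>i<n. K (x (Suc i)) (x i)) * ?q)"
    unfolding time_reversal_path[OF rev] by simp
  also have "(\<Prod>i<n. K (x (Suc i)) (x i)) * ?q =
      (\<Prod>i<n. of_bool (f i (x (Suc i)) = x i) * measure \<nu> (map_fiber \<phi> \<nu> (f i)))"
    unfolding prod.distrib[symmetric] driving_law_given_map_fiber[OF rule] ..
  also have "\<dots> = of_bool (\<forall>i<n. f i (x (Suc i)) = x i) * (\<Prod>i<n. measure \<nu> (map_fiber \<phi> \<nu> (f i)))"
    by (auto simp: prod.distrib)
  finally show ?thesis
    by (simp add: of_bool_conj mult_ac)
qed

text \<open>A path along which \<open>f\<close> maps each state to its successor is determined by its starting point.\<close>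

lemma sum_driven_paths:
  fixes f :: "nat \<Rightarrow> 'a::finite \<Rightarrow> 'a" and h :: "'a \<Rightarrow> real"
  shows "(\<Sum>x\<in>{..n} \<rightarrow>\<^sub>E UNIV. of_bool (x 0 = z \<and> (\<forall>i<n. f i (x (Suc i)) = x i)) * h (x n)) =
    (\<Sum>a\<in>UNIV. of_bool (trajectory (\<lambda>x g. g x) f n a n = z) * h a)"
proof -
  \<comment> \<open>Index \<open>i\<close> stands for time \<open>-i\<close>, which a trajectory
    from time \<open>-n\<close> reaches after \<open>n - i\<close> steps. The start \<open>a\<close>
    is the value at index \<open>n\<close>, whence injectivity.\<close>
  let ?path = "\<lambda>a. restrict (\<lambda>i. trajectory (\<lambda>x g. g x) f n a (n - i)) {..n}"
  let ?w = "\<lambda>x. of_bool (x 0 = z \<and> (\<forall>i<n. f i (x (Suc i)) = x i)) * h (x n)"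
  have path_step: "f i (?path a (Suc i)) = ?path a i" if "i < n" for a i
  proof -
    have "n - i = Suc (n - Suc i)" "n - Suc (n - Suc i) = i" using that by auto
    then show ?thesis using that by simp
  qed
  have inj: "inj ?path"
    by (rule injI) (drule fun_cong[where x=n], simp)
  have "?w x = 0" if x: "x \<in> {..n} \<rightarrow>\<^sub>E UNIV" "x \<notin> range ?path" for x
  proof (rule ccontr)
    assume "?w x \<noteq> 0"
    then have driven: "\<And>i. i < n \<Longrightarrow> f i (x (Suc i)) = x i"
      by (auto split: if_splits)
    \<comment> \<open>The induction descends from index \<open>n\<close>, that is, forward in
      time.\<close>
    have path: "x i = ?path (x n) i" if "i \<le> n" for i
      using that
    proof (induction i rule: inc_induct)
      case (step i)
      then show ?case
        using driven[of i] path_step[of i "x n"] by simp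
    qed simp
    have "x = ?path (x n)"
    proof (rule PiE_ext[OF x(1)])
      show "?path (x n) \<in> {..n} \<rightarrow>\<^sub>E UNIV" by simp
    qed (rule path, simp)
    with x(2) show False by blast
  qed
  then have "(\<Sum>x\<in>{..n} \<rightarrow>\<^sub>E UNIV. ?w x) = (\<Sum>x\<in>range ?path. ?w x)"
  proof (intro sum.mono_neutral_right ballI)
    show "range ?path \<subseteq> {..n} \<rightarrow>\<^sub>E UNIV"
      by (simp add: image_subset_iff)
  qed (auto intro: finite_PiE)
  also have "\<dots> = (\<Sum>a\<in>UNIV. ?w (?path a))"
    by (simp only: sum.reindex[OF inj] o_def)
  also have "\<dots> = (\<Sum>a\<in>UNIV. of_bool (trajectory (\<lambda>x g. g x) f n a n = z) * h a)"
    using path_step by (intro sum.cong refl) simp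
  finally show ?thesis .
qed

text \<open>Summing out the hidden path leaves the \<pi>-mass of those starts that \<open>f\<close>
  sends to \<open>z\<close>, times the weight of \<open>f\<close> under independent driving.\<close>

lemma fmmr_run_maps:
  fixes \<phi> :: "'a::finite \<Rightarrow> 'u \<Rightarrow> 'a"
  assumes rule: "transition_rule K \<phi> \<nu>" and rev: "time_reversal \<pi> K Kt"
    and run: "fmmr_run \<phi> \<nu> Kt z N X V"
  shows "pmf \<pi> z * measure N {\<omega> \<in> space N. \<forall>i<n. (\<lambda>x. \<phi> x (V i \<omega>)) = f i} =
    (\<Sum>a\<in>UNIV. of_bool (trajectory (\<lambda>x g. g x) f n a n = z) * pmf \<pi> a) *
      (\<Prod>i<n. measure \<nu> (map_fiber \<phi> \<nu> (f i)))"
proof -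
  interpret prob_space N
    using run by (simp add: fmmr_run_def)
  have \<phi>: "\<And>x. \<phi> x \<in> measurable \<nu> (count_space UNIV)"
    using rule by (auto simp: transition_rule_def)
  have V [measurable]: "V i \<in> measurable N \<nu>" and X: "X i \<in> measurable N (count_space UNIV)" for i
    using run by (auto simp: fmmr_run_def)
  note [measurable] = measurable_driving_map[OF \<phi>]
  have "(\<lambda>\<omega>. (\<lambda>u x. \<phi> x u) (V i \<omega>)) \<in> measurable N (count_space UNIV)" for i
    by measurable
  then have [measurable]: "(\<lambda>\<omega> x. \<phi> x (V i \<omega>)) \<in> measurable N (count_space UNIV)" for i .
  have "Measurable.pred N (\<lambda>\<omega>. \<forall>i<n. (\<lambda>x. \<phi> x (V i \<omega>)) = f i)"
    by measurable
  \<comment> \<open>The \<open>n\<close> updates join \<open>n + 1\<close> states, hence the index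
    set \<open>{..n}\<close>.\<close>
  from measure_sum_values[where F=X and I="{..n}", OF finite_atMost X this]
  have "prob {\<omega> \<in> space N. \<forall>i<n. (\<lambda>x. \<phi> x (V i \<omega>)) = f i} = (\<Sum>x\<in>{..n} \<rightarrow>\<^sub>E UNIV.
      prob {\<omega> \<in> space N. (\<forall>i<n. (\<lambda>x. \<phi> x (V i \<omega>)) = f i) \<and> (\<forall>i\<le>n. X i \<omega> = x i)})"
    by (simp only: Ball_def atMost_iff)
  then show ?thesis
    by (simp only: sum_distrib_left fmmr_run_path[OF assms] sum_driven_paths flip: sum_distrib_right)
qed

text \<open>Both sides are sums over the finitely many sequences \<open>f\<close> of maps, and they
  agree term by term. The product form avoids dividing by \<open>pmf \<pi> z\<close>, which is not
  yet identified with the law of the output.\<close>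

lemma coalescence_cftp_fmmr:
  fixes \<phi> :: "'a::finite \<Rightarrow> 'u \<Rightarrow> 'a"
  assumes rule: "transition_rule K \<phi> \<nu>" and rev: "time_reversal \<pi> K Kt"
    and iid: "iid_copies \<nu> M U" and run: "fmmr_run \<phi> \<nu> Kt z N X V"
  shows "measure M {\<omega> \<in> space M. coalesces_to \<phi> (\<lambda>i. U i \<omega>) t z} =
    pmf \<pi> z * measure N {\<omega> \<in> space N. \<exists>z'. coalesces_to \<phi> (\<lambda>i. V i \<omega>) t z'}"
proof -
  interpret M: prob_space M
    using iid by (simp add: iid_copies_def)
  interpret N: prob_space N
    using run by (simp add: fmmr_run_def)
  have \<phi>: "\<And>x. \<phi> x \<in> measurable \<nu> (count_space UNIV)"
    using rule by (auto simp: transition_rule_def)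
  have V: "V i \<in> measurable N \<nu>" for i
    using run by (auto simp: fmmr_run_def)
  have U: "U i \<in> measurable M \<nu>" for i
    using iid by (auto simp: iid_copies_def M.indep_vars_def)
  have UV: "(\<lambda>\<omega> x. \<phi> x (U i \<omega>)) \<in> measurable M (count_space UNIV)"
    "(\<lambda>\<omega> x. \<phi> x (V i \<omega>)) \<in> measurable N (count_space UNIV)" for i
    using measurable_compose[OF U measurable_driving_map[OF \<phi>]]
      measurable_compose[OF V measurable_driving_map[OF \<phi>]] by simp_all
  note [measurable] = pred_coalesces_to[OF \<phi> U] pred_coalesces_to[OF \<phi> V]
  let ?F = "{..<t} \<rightarrow>\<^sub>E (UNIV :: ('a \<Rightarrow> 'a) set)"
  let ?c = "coalesces_to (\<lambda>x g. g x)"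
  let ?w = "\<lambda>f. \<Prod>i<t. measure \<nu> (map_fiber \<phi> \<nu> (f i))"
  have "measure M {\<omega> \<in> space M. coalesces_to \<phi> (\<lambda>i. U i \<omega>) t z} =
    (\<Sum>f\<in>?F. measure M {\<omega> \<in> space M. coalesces_to \<phi> (\<lambda>i. U i \<omega>) t z \<and>
      (\<forall>i\<in>{..<t}. (\<lambda>x. \<phi> x (U i \<omega>)) = f i)})"
    by (intro M.measure_sum_values UV) auto
  also have "\<dots> = (\<Sum>f\<in>?F. of_bool (?c f t z) * ?w f)"
  proof (rule sum.cong[OF refl])
    fix f
    have "{\<omega> \<in> space M. coalesces_to \<phi> (\<lambda>i. U i \<omega>) t z \<and> (\<forall>i\<in>{..<t}. (\<lambda>x. \<phi> x (U i \<omega>)) = f i)} =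
      (if ?c f t z then {\<omega> \<in> space M. \<forall>i<t. (\<lambda>x. \<phi> x (U i \<omega>)) = f i} else {})"
      using coalesces_to_maps_cong[of t \<phi> "\<lambda>i. U i _" f z] by auto
    then show "measure M {\<omega> \<in> space M. coalesces_to \<phi> (\<lambda>i. U i \<omega>) t z \<and>
        (\<forall>i\<in>{..<t}. (\<lambda>x. \<phi> x (U i \<omega>)) = f i)} = of_bool (?c f t z) * ?w f"
      by (simp add: iid_copies_maps[OF \<phi> iid])
  qed
  also have "\<dots> = (\<Sum>f\<in>?F. pmf \<pi> z * measure N {\<omega> \<in> space N.
      (\<exists>z'. coalesces_to \<phi> (\<lambda>i. V i \<omega>) t z') \<and> (\<forall>i\<in>{..<t}. (\<lambda>x. \<phi> x (V i \<omega>)) = f i)})"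
  proof (rule sum.cong[OF refl])
    fix f
    have *: "{\<omega> \<in> space N. (\<exists>z'. coalesces_to \<phi> (\<lambda>i. V i \<omega>) t z') \<and>
        (\<forall>i\<in>{..<t}. (\<lambda>x. \<phi> x (V i \<omega>)) = f i)} =
      (if \<exists>z'. ?c f t z' then {\<omega> \<in> space N. \<forall>i<t. (\<lambda>x. \<phi> x (V i \<omega>)) = f i} else {})"
      using coalesces_to_maps_cong[of t \<phi> "\<lambda>i. V i _" f] by auto
    show "of_bool (?c f t z) * ?w f = pmf \<pi> z * measure N {\<omega> \<in> space N.
      (\<exists>z'. coalesces_to \<phi> (\<lambda>i. V i \<omega>) t z') \<and> (\<forall>i\<in>{..<t}. (\<lambda>x. \<phi> x (V i \<omega>)) = f i)}"
    proof (cases "\<exists>z'. ?c f t z'")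
      case True
      then obtain z' where z': "?c f t z'" ..
      \<comment> \<open>All starts end in \<open>z'\<close>, so the sum is the total mass of \<pi>
        or empty. Hence a run from \<open>z\<close> sees only coalescence to \<open>z\<close>, up to
        the factor \<open>pmf \<pi> z\<close>.\<close>
      have "(\<Sum>a\<in>UNIV. of_bool (trajectory (\<lambda>x g. g x) f t a t = z) * pmf \<pi> a) = of_bool (z' = z)"
        using z' sum_pmf_eq_1[of UNIV \<pi>] by (auto simp: coalesces_to_def)
      moreover have "?c f t z \<longleftrightarrow> z' = z"
        using z' coalesces_to_unique by metis
      ultimately show ?thesis
        unfolding * by (simp add: True fmmr_run_maps[OF rule rev run])
    next
    case False
    then show ?thesis
      unfolding * by (simp only: if_False) simp
  qed
  qed
  also have "\<dots> = pmf \<pi> z * measure N {\<omega> \<in> space N. \<exists>z'. coalesces_to \<phi> (\<lambda>i. V i \<omega>) t z'}"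
    unfolding sum_distrib_left[symmetric]
    by (intro arg_cong2[where f="(*)"] refl N.measure_sum_values[symmetric] UV) auto
  finally show ?thesis .
qed


section \<open>The output of CFTP\<close>

lemma measurable_coalescence_time:
  fixes \<phi> :: "'a::finite \<Rightarrow> 'u \<Rightarrow> 'a"
  assumes "\<And>x. \<phi> x \<in> measurable \<nu> (count_space UNIV)" "\<And>i. W i \<in> measurable Q \<nu>"
  shows "(\<lambda>\<omega>. coalescence_time \<phi> (\<lambda>i. W i \<omega>)) \<in> measurable Q (count_space UNIV)"
proof (rule measurable_enatI)
  note [measurable] = pred_coalesces_to[OF assms]
  show "{\<omega> \<in> space Q. coalescence_time \<phi> (\<lambda>i. W i \<omega>) \<le> enat t} \<in> sets Q" for t
    unfolding coalescence_time_le_iff by measurable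
qed

text \<open>
  On the event that the coalescence time is infinite, \<open>coalescence_value\<close> is a definite description
  of an empty predicate, hence the same for all \<open>\<omega>\<close>.
\<close>

lemma measurable_coalescence_value:
  fixes \<phi> :: "'a::finite \<Rightarrow> 'u \<Rightarrow> 'a"
  assumes "\<And>x. \<phi> x \<in> measurable \<nu> (count_space UNIV)" "\<And>i. W i \<in> measurable Q \<nu>"
  shows "(\<lambda>\<omega>. coalescence_value \<phi> (\<lambda>i. W i \<omega>)) \<in> measurable Q (count_space UNIV)"
proof -
  note [measurable] = pred_coalesces_to[OF assms]
  define d :: 'a where "d = (THE z. False)"
  have *: "coalescence_value \<phi> u = z \<longleftrightarrow>
      (\<exists>t. coalesces_to \<phi> u t z) \<or> (\<forall>t z'. \<not> coalesces_to \<phi> u t z') \<and> z = d" for u z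
  proof (cases "\<exists>t z'. coalesces_to \<phi> u t z'")
    case True
    then show ?thesis using coalescence_value_eq by metis
  next
    case False
    then have "coalescence_value \<phi> u = d"
      by (simp add: coalescence_value_def d_def)
    then show ?thesis using False by auto
  qed
  have "{\<omega> \<in> space Q. coalescence_value \<phi> (\<lambda>i. W i \<omega>) = z} \<in> sets Q" for z
    unfolding * by measurable
  then show ?thesis
    by (subst measurable_count_space_eq2) (auto simp: vimage_def Int_def conj_commute)
qed

lemma cftp_output_stationary:
  fixes \<phi> :: "'a::finite \<Rightarrow> 'u \<Rightarrow> 'a"
  assumes \<phi>: "\<And>x. \<phi> x \<in> measurable \<nu> (count_space UNIV)"
    and iid: "iid_copies \<nu> M U"
    and fin: "AE \<omega> in M. T_cftp \<phi> U \<omega> < \<infinity>"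
    and le: "\<And>t z. measure M {\<omega> \<in> space M. coalesces_to \<phi> (\<lambda>i. U i \<omega>) t z} \<le> pmf \<pi> z"
  shows "measure M {\<omega> \<in> space M. Z_cftp \<phi> U \<omega> = z} = pmf \<pi> z"
proof -
  interpret prob_space M
    using iid by (simp add: iid_copies_def)
  have U: "U i \<in> measurable M \<nu>" for i
    using iid by (auto simp: iid_copies_def indep_vars_def)
  note [measurable] = pred_coalesces_to[OF \<phi> U]
  have Z [measurable]: "Z_cftp \<phi> U \<in> measurable M (count_space UNIV)"
    using measurable_coalescence_value[OF \<phi> U] by (simp add: Z_cftp_def[abs_def])
  let ?C = "\<lambda>z t. {\<omega> \<in> space M. coalesces_to \<phi> (\<lambda>i. U i \<omega>) t z}"
  have Z_le: "prob {\<omega> \<in> space M. Z_cftp \<phi> U \<omega> = z} \<le> pmf \<pi> z" for z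
  proof -
    have "(\<lambda>t. prob (?C z t)) \<longlonglongrightarrow> prob (\<Union>t. ?C z t)"
      by (intro finite_Lim_measure_incseq) (auto simp: incseq_def intro: coalesces_to_mono)
    then have "prob (\<Union>t. ?C z t) \<le> pmf \<pi> z"
      by (rule LIMSEQ_le_const2) (use le in auto)
    \<comment> \<open>Almost sure termination enters here: an output \<open>z\<close> comes from
      coalescence to \<open>z\<close> in some finite window.\<close>
    moreover have "prob {\<omega> \<in> space M. Z_cftp \<phi> U \<omega> = z} \<le> prob (\<Union>t. ?C z t)"
    proof (rule finite_measure_mono_AE)
      show "AE \<omega> in M. \<omega> \<in> {\<omega> \<in> space M. Z_cftp \<phi> U \<omega> = z} \<longrightarrow> \<omega> \<in> (\<Union>t. ?C z t)"
        using fin by eventually_elim (auto simp: T_cftp_def Z_cftp_def coalesces_to_iff)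
    qed measurable
    ultimately show ?thesis by simp
  qed
  have "(\<Sum>z\<in>UNIV. prob {\<omega> \<in> space M. Z_cftp \<phi> U \<omega> = z}) = prob (\<Union>z. {\<omega> \<in> space M. Z_cftp \<phi> U \<omega> = z})"
    by (intro finite_measure_finite_Union[symmetric]) (auto simp: disjoint_family_on_def)
  also have "(\<Union>z. {\<omega> \<in> space M. Z_cftp \<phi> U \<omega> = z}) = space M"
    by auto
  also have "prob (space M) = (\<Sum>z\<in>UNIV. pmf \<pi> z)"
    using prob_space sum_pmf_eq_1[of UNIV \<pi>] by simp
  \<comment> \<open>Termwise inequality between finite sums with equal totals forces equality in
    each term.\<close>
  finally show ?thesis
    by (rule sum_mono_inv) (use Z_le in auto)
qed

section \<open>Conditional probabilities, conditional laws and the mixture\<close>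

theorem theorem2p3:
  fixes K Kt :: "'a::finite \<Rightarrow> 'a \<Rightarrow> real"
    and \<pi> :: "'a pmf"
    and \<phi> :: "'a \<Rightarrow> 'u \<Rightarrow> 'a"
    and \<nu> :: "'u measure"
    and M :: "'w measure"
    and U :: "nat \<Rightarrow> 'w \<Rightarrow> 'u"
    and N :: "'a \<Rightarrow> 'v measure"
    and X :: "'a \<Rightarrow> nat \<Rightarrow> 'v \<Rightarrow> 'a"
    and V :: "'a \<Rightarrow> nat \<Rightarrow> 'v \<Rightarrow> 'u"
  assumes "stochastic K"
    and "irreducible_chain K"
    and "aperiodic_chain K"
    and "stationary_distribution K \<pi>"
    and "transition_rule K \<phi> \<nu>"
    and "iid_copies \<nu> M U"
    and "AE \<omega> in M. T_cftp \<phi> U \<omega> < \<infinity>"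
    and "time_reversal \<pi> K Kt"
    and "\<And>z. fmmr_run \<phi> \<nu> Kt z (N z) (X z) (V z)"
  shows "(\<forall>t. AE z in measure_pmf \<pi>. p_cftp_given \<phi> M U t z = p_fmmr \<phi> N V t z)
    \<and> (\<forall>t. p_cftp \<phi> M U t = measure_pmf.expectation \<pi> (\<lambda>z. p_fmmr \<phi> N V t z)
         \<and> measure_pmf.expectation \<pi> (\<lambda>z. p_fmmr \<phi> N V t z)
             = (\<Sum>z\<in>UNIV. pmf \<pi> z * p_fmmr \<phi> N V t z))
    \<and> (AE z in measure_pmf \<pi>. law_T_cftp_given \<phi> M U z = law_T_fmmr_given \<phi> N V z)
    \<and> law_T_cftp \<phi> M U = Giry_Monad.bind (measure_pmf \<pi>) (law_T_fmmr_given \<phi> N V)"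
proof -
  note rule = assms(5) and iid = assms(6) and fin = assms(7) and rev = assms(8) and run = assms(9)
  interpret M: prob_space M
    using iid by (simp add: iid_copies_def)
  have N: "prob_space (N z)" for z
    using run[of z] by (simp add: fmmr_run_def)
  have \<phi>: "\<And>x. \<phi> x \<in> measurable \<nu> (count_space UNIV)"
    using rule by (auto simp: transition_rule_def)
  have V: "V z i \<in> measurable (N z) \<nu>" for z i
    using run[of z] by (auto simp: fmmr_run_def)
  have U: "U i \<in> measurable M \<nu>" for i
    using iid by (auto simp: iid_copies_def M.indep_vars_def)
  note [measurable] = pred_coalesces_to[OF \<phi> U]
  have T [measurable]: "T_cftp \<phi> U \<in> measurable M (count_space UNIV)"
    using measurable_coalescence_time[OF \<phi> U] by (simp add: T_cftp_def[abs_def])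
  have Tf: "T_fmmr \<phi> (V z) \<in> measurable (N z) (count_space UNIV)" for z
    using measurable_coalescence_time[OF \<phi> V] by (simp add: T_fmmr_def[abs_def])
  have Z [measurable]: "Z_cftp \<phi> U \<in> measurable M (count_space UNIV)"
    using measurable_coalescence_value[OF \<phi> U] by (simp add: Z_cftp_def[abs_def])

  have joint: "measure M {\<omega> \<in> space M. coalesces_to \<phi> (\<lambda>i. U i \<omega>) t z} = pmf \<pi> z * p_fmmr \<phi> N V t z"
    for t z
    unfolding p_fmmr_def T_fmmr_def coalescence_time_le_iff
    by (rule coalescence_cftp_fmmr[OF rule rev iid run])
  have "p_fmmr \<phi> N V t z \<le> 1" for t z
    unfolding p_fmmr_def by (rule prob_space.prob_le_1[OF N])
  then have stationary: "measure M {\<omega> \<in> space M. Z_cftp \<phi> U \<omega> = z} = pmf \<pi> z" for z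
    by (intro cftp_output_stationary[OF \<phi> iid fin]) (simp add: joint mult_left_le)

  \<comment> \<open>The conditioning event has probability \<open>pmf \<pi> z\<close>, nonzero on
    the support, and this factor cancels in \<open>joint\<close>.\<close>
  have given: "p_cftp_given \<phi> M U t z = p_fmmr \<phi> N V t z" if "z \<in> set_pmf \<pi>" for t z
    using that joint[of t z] stationary[of z]
    by (simp add: p_cftp_given_def cond_prob_def T_cftp_def Z_cftp_def coalesces_to_iff set_pmf_iff)

  have expectation: "measure_pmf.expectation \<pi> (p_fmmr \<phi> N V t) = (\<Sum>z\<in>UNIV. pmf \<pi> z * p_fmmr \<phi> N V t z)"
    for t
    by (subst integral_measure_pmf_real[of UNIV]) (auto simp: mult.commute)

  have mixture: "p_cftp \<phi> M U t = (\<Sum>z\<in>UNIV. pmf \<pi> z * p_fmmr \<phi> N V t z)" for t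
  proof -
    \<comment> \<open>Splitting by the common value gives a disjoint union, since coalescence has
      only one value.\<close>
    have "{\<omega> \<in> space M. T_cftp \<phi> U \<omega> \<le> enat t} =
        (\<Union>z. {\<omega> \<in> space M. coalesces_to \<phi> (\<lambda>i. U i \<omega>) t z})"
      by (auto simp: T_cftp_def coalescence_time_le_iff)
    also have "measure M \<dots> = (\<Sum>z\<in>UNIV. measure M {\<omega> \<in> space M. coalesces_to \<phi> (\<lambda>i. U i \<omega>) t z})"
      by (intro M.finite_measure_finite_Union)
        (auto simp: disjoint_family_on_def dest: coalesces_to_unique)
    finally show ?thesis
      by (simp add: p_cftp_def joint)
  qed

  have prob_fmmr: "prob_space (law_T_fmmr_given \<phi> N V z)" for z
    unfolding law_T_fmmr_given_def by (rule prob_space.prob_space_distr[OF N Tf])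
  have sets_fmmr: "sets (law_T_fmmr_given \<phi> N V z) = UNIV" for z
    by (simp add: law_T_fmmr_given_def)
  have cdf_fmmr: "measure (law_T_fmmr_given \<phi> N V z) {..enat t} = p_fmmr \<phi> N V t z" for t z
    unfolding law_T_fmmr_given_def p_fmmr_def
    by (subst measure_distr[OF Tf]) (auto intro!: arg_cong[where f="measure _"])

  have law_given: "law_T_cftp_given \<phi> M U z = law_T_fmmr_given \<phi> N V z" if z: "z \<in> set_pmf \<pi>" for z
  proof (rule measure_eqI_enat)
    let ?Q = "uniform_measure M {\<omega> \<in> space M. Z_cftp \<phi> U \<omega> = z}"
    have "measure M {\<omega> \<in> space M. Z_cftp \<phi> U \<omega> = z} \<noteq> 0"
      using z by (simp add: stationary set_pmf_iff)
    then have Q: "prob_space ?Q"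
      by (intro prob_space_uniform_measure) (auto simp: M.emeasure_eq_measure)
    have TQ: "T_cftp \<phi> U \<in> measurable ?Q (count_space UNIV)"
      by simp
    show "prob_space (law_T_cftp_given \<phi> M U z)"
      unfolding law_T_cftp_given_def by (rule prob_space.prob_space_distr[OF Q TQ])
    show "sets (law_T_cftp_given \<phi> M U z) = UNIV"
      by (simp add: law_T_cftp_given_def)
    fix t
    have "measure (law_T_cftp_given \<phi> M U z) {..enat t} =
        measure ?Q {\<omega> \<in> space M. T_cftp \<phi> U \<omega> \<le> enat t}"
      unfolding law_T_cftp_given_def
      by (subst measure_distr[OF TQ]) (auto intro!: arg_cong[where f="measure _"])
    also have "\<dots> = p_cftp_given \<phi> M U t z"
      unfolding p_cftp_given_def
      using M.measure_uniform_measure_eq_cond_prob[of "\<lambda>\<omega>. T_cftp \<phi> U \<omega> \<le> enat t" "\<lambda>\<omega>. Z_cftp \<phi> U \<omega> = z"]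
      by simp
    also have "\<dots> = measure (law_T_fmmr_given \<phi> N V z) {..enat t}"
      by (simp add: given[OF z] cdf_fmmr)
    finally show "measure (law_T_cftp_given \<phi> M U z) {..enat t} =
        measure (law_T_fmmr_given \<phi> N V z) {..enat t}" .
  qed (rule prob_fmmr sets_fmmr)+

  have law: "law_T_cftp \<phi> M U = Giry_Monad.bind (measure_pmf \<pi>) (law_T_fmmr_given \<phi> N V)"
  proof (rule measure_eqI_enat)
    let ?L = "law_T_fmmr_given \<phi> N V"
    \<comment> \<open>All sets are measurable for \<pi>, so only membership in the space of
      subprobability measures has to be checked.\<close>
    have L: "?L \<in> measurable (measure_pmf \<pi>) (subprob_algebra (count_space UNIV))"
      using prob_fmmr sets_fmmr
      by (auto simp: space_subprob_algebra intro: prob_space_imp_subprob_space)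
    show "prob_space (law_T_cftp \<phi> M U)"
      unfolding law_T_cftp_def by (rule M.prob_space_distr[OF T])
    show "prob_space (Giry_Monad.bind (measure_pmf \<pi>) ?L)"
      by (rule measure_pmf.prob_space_bind[OF _ L]) (simp add: prob_fmmr)
    show "sets (law_T_cftp \<phi> M U) = UNIV"
      by (simp add: law_T_cftp_def)
    show "sets (Giry_Monad.bind (measure_pmf \<pi>) ?L) = UNIV"
      by (subst sets_bind[where N="count_space UNIV"]) (auto simp: sets_fmmr)
    fix t
    have "measure (law_T_cftp \<phi> M U) {..enat t} = p_cftp \<phi> M U t"
      unfolding law_T_cftp_def p_cftp_def
      by (subst measure_distr[OF T]) (auto intro!: arg_cong[where f="measure _"])
    also have "\<dots> = measure_pmf.expectation \<pi> (\<lambda>z. measure (?L z) {..enat t})"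
      by (simp add: mixture cdf_fmmr expectation)
    also have "\<dots> = measure (Giry_Monad.bind (measure_pmf \<pi>) ?L) {..enat t}"
      by (rule measure_pmf.measure_bind[OF L, symmetric]) simp
    finally show "measure (law_T_cftp \<phi> M U) {..enat t} =
        measure (Giry_Monad.bind (measure_pmf \<pi>) ?L) {..enat t}" .
  qed

  show ?thesis
    using given law_given law by (simp add: AE_measure_pmf_iff mixture expectation)
qed

end
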